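(* For every class of graphs $\mathcal{C}$ with bounded expansion and every $d\in\mathbb{N}$, there exists a constant $c\in\mathbb{N}$ such that $$\frac{1}{c}\cdot\mathrm{col}(H)\leq\omega(H)\leq\chi(H)\leq\mathrm{col}(H)\qquad\text{for all } H\in\overline{\mathcal{C}^d}.$$
   Context: All graphs are finite, simple and undirected. $G^d$ is the graph on $V(G)$ where distinct $u,v$ are adjacent iff their distance in $G$ is at most $d$; $\mathcal{C}^d=\{G^d:G\in\mathcal{C}\}$; $\overline{\mathcal{D}}$ denotes the hereditary closure of a class $\mathcal{D}$, i.e. all induced subgraphs of graphs in $\mathcal{D}$. $\omega(H)$ is the clique number and $\chi(H)$ the chromatic number. For a vertex ordering $\sigma$ of $H$, $\mathrm{col}(H,\sigma)=1+\max_{u}|\{v: uv\in E(H),\ v<_\sigma u\}|$, and the coloring number $\mathrm{col}(H)$ is the minimum of $\mathrm{col}(H,\sigma)$ over all vertex orderings. A graph is a depth-$r$ minor of $G$ if it is obtained from a subgraph of $G$ by contracting pairwise disjoint connected subgraphs of radius at most $r$; a class $\mathcal{C}$ has bounded expansion if for every $r\in\mathbb{N}$ the ratio of edges to vertices of depth-$r$ minors of graphs in $\mathcal{C}$ is bounded. *)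

theory Defs
  imports Complex_Main "HOL-Library.Extended_Nat"
begin

datatype 'a graph = Graph (verts: "'a set") (edges: "'a set set")

definition fin_simple_graph :: "'a graph \<Rightarrow> bool" where
  "fin_simple_graph G \<longleftrightarrow>
     finite (verts G) \<and> (\<forall>e\<in>edges G. e \<subseteq> verts G \<and> card e = 2)"

definition subgraph :: "'a graph \<Rightarrow> 'a graph \<Rightarrow> bool" where
  "subgraph H G \<longleftrightarrow>
     verts H \<subseteq> verts G \<and> edges H \<subseteq> edges G \<and> (\<forall>e\<in>edges H. e \<subseteq> verts H)"

definition induced_subgraph :: "'a graph \<Rightarrow> 'a graph \<Rightarrow> bool" where
  "induced_subgraph H G \<longleftrightarrow>
     verts H \<subseteq> verts G \<and> edges H = {e \<in> edges G. e \<subseteq> verts H}"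

definition hereditary_closure :: "'a graph set \<Rightarrow> 'a graph set" where
  "hereditary_closure D = {H. \<exists>G\<in>D. induced_subgraph H G}"

text \<open>A walk is the nonempty list of its vertices; its length is the number of its steps.\<close>

definition walk :: "'a graph \<Rightarrow> 'a \<Rightarrow> 'a list \<Rightarrow> 'a \<Rightarrow> bool" where
  "walk G u p v \<longleftrightarrow>
     p \<noteq> [] \<and> hd p = u \<and> last p = v \<and> set p \<subseteq> verts G \<and>
     (\<forall>i. Suc i < length p \<longrightarrow> {p ! i, p ! Suc i} \<in> edges G)"

text \<open>The distance is \<open>\<infinity>\<close>, the infimum of the empty set, between vertices not joined by a walk.\<close>

definition gdist :: "'a graph \<Rightarrow> 'a \<Rightarrow> 'a \<Rightarrow> enat" where
  "gdist G u v = (INF p\<in>{p. walk G u p v}. enat (length p - 1))"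

definition graph_power :: "nat \<Rightarrow> 'a graph \<Rightarrow> 'a graph" where
  "graph_power d G =
     Graph (verts G)
       {{u, v} | u v. u \<in> verts G \<and> v \<in> verts G \<and> u \<noteq> v \<and> gdist G u v \<le> enat d}"

definition connected_graph :: "'a graph \<Rightarrow> bool" where
  "connected_graph G \<longleftrightarrow>
     verts G \<noteq> {} \<and> (\<forall>u\<in>verts G. \<forall>v\<in>verts G. gdist G u v \<noteq> \<infinity>)"

definition radius :: "'a graph \<Rightarrow> enat" where
  "radius G = (INF u\<in>verts G. SUP v\<in>verts G. gdist G u v)"

text \<open>The vertices of the contracted graph are sets of old vertices: the vertex sets of the
  contracted subgraphs, and a singleton for each vertex outside all of them. Loops and parallel
  edges arising from the contraction are discarded.\<close>

definition contract :: "'a graph \<Rightarrow> 'a graph set \<Rightarrow> 'a set graph" where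
  "contract G S =
     (let B = verts ` S \<union> {{v} | v. v \<in> verts G \<and> (\<forall>A\<in>S. v \<notin> verts A)}
      in Graph B
           {{X, Y} | X Y. X \<in> B \<and> Y \<in> B \<and> X \<noteq> Y \<and> (\<exists>x\<in>X. \<exists>y\<in>Y. {x, y} \<in> edges G)})"

definition depth_minor :: "nat \<Rightarrow> 'a set graph \<Rightarrow> 'a graph \<Rightarrow> bool" where
  "depth_minor r M G \<longleftrightarrow>
     (\<exists>G' S. subgraph G' G \<and>
        (\<forall>A\<in>S. subgraph A G' \<and> connected_graph A \<and> radius A \<le> enat r) \<and>
        pairwise (\<lambda>A B. disjnt (verts A) (verts B)) S \<and>
        M = contract G' S)"

text \<open>The ratio is real division, so it is \<open>0\<close> for the minor without vertices.\<close>

definition bounded_expansion :: "'a graph set \<Rightarrow> bool" where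
  "bounded_expansion C \<longleftrightarrow>
     (\<forall>r. \<exists>b::real. \<forall>G\<in>C. \<forall>M. depth_minor r M G \<longrightarrow>
        real (card (edges M)) / real (card (verts M)) \<le> b)"

definition clique :: "'a graph \<Rightarrow> 'a set \<Rightarrow> bool" where
  "clique G K \<longleftrightarrow> K \<subseteq> verts G \<and> (\<forall>u\<in>K. \<forall>v\<in>K. u \<noteq> v \<longrightarrow> {u, v} \<in> edges G)"

definition clique_number :: "'a graph \<Rightarrow> nat" where
  "clique_number G = Max {card K | K. clique G K}"

definition proper_coloring :: "'a graph \<Rightarrow> nat \<Rightarrow> ('a \<Rightarrow> nat) \<Rightarrow> bool" where
  "proper_coloring G k f \<longleftrightarrow>
     (\<forall>v\<in>verts G. f v < k) \<and>
     (\<forall>u\<in>verts G. \<forall>v\<in>verts G. {u, v} \<in> edges G \<longrightarrow> f u \<noteq> f v)"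

definition chromatic_number :: "'a graph \<Rightarrow> nat" where
  "chromatic_number G = (LEAST k. \<exists>f. proper_coloring G k f)"

text \<open>A vertex ordering is a reflexive linear order on the vertex set, with \<open>(v, u) \<in> \<sigma>\<close> read as
  \<open>v \<le> u\<close>. For the graph without vertices, where the maximum is over the empty set, the
  coloring number is \<open>0\<close>, in line with its clique number and chromatic number.\<close>

definition col_ord :: "'a graph \<Rightarrow> ('a \<times> 'a) set \<Rightarrow> nat" where
  "col_ord G \<sigma> =
     (if verts G = {} then 0
      else 1 + Max ((\<lambda>u. card {v. {u, v} \<in> edges G \<and> (v, u) \<in> \<sigma> \<and> v \<noteq> u}) ` verts G))"

definition col :: "'a graph \<Rightarrow> nat" where
  "col G = Min {col_ord G \<sigma> | \<sigma>. linear_order_on (verts G) \<sigma>}"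

end

(*
  Bounded expansion gives a ranking of the vertices such that no vertex has a large fan of short
  paths to smaller vertices, and then all weak d-reachability sets have bounded size k. The least
  vertex z of a walk of length at most d between u and v is weakly reachable from both ends and
  within d/2 of one of them. All vertices within d/2 of z are pairwise adjacent in the d-th power,
  so an induced subgraph H of the power contains at most omega(H) of them. Orienting every edge of
  H towards the end that is near z gives out-degrees at most k * omega(H), so H is
  2 k omega(H)-degenerate.
*)

theory Submission
  imports Defs "HOL-Library.Disjoint_Sets"
begin

section \<open>Walks and distances\<close>

text \<open>The clique number has to enter the bound: the square of a star is complete, so powers of
  very sparse graphs can have unbounded degeneracy. Weak reachability controls only the number of
  middle vertices \<open>z\<close>, which need not belong to \<open>H\<close>; how many vertices lie
  near \<open>z\<close> is controlled only inside \<open>H\<close>, by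
  \<open>clique_number H\<close>.

  A ranking cannot be chosen greedily for weak reachability itself, because the set reached from
  \<open>v\<close> depends on how the smaller vertices are ordered among themselves. The fan
  condition at \<open>v\<close> depends only on which vertices are smaller. So a vertex with only
  small fans into the rest can be put last, and the rest can be treated in the same way.

  The orientation of \<open>H\<close> need not follow this ranking or be acyclic. Its out-degree
  bound holds inside every vertex set and therefore bounds the average degree there, which costs the
  factor 2; the ordering of \<open>H\<close> then comes from degeneracy.\<close>

abbreviation adj :: "'a graph \<Rightarrow> 'a \<Rightarrow> 'a \<Rightarrow> bool" where
  "adj G x y \<equiv> {x, y} \<in> edges G"

lemma walk_iff_successively:
  "walk G u p v \<longleftrightarrow>
     p \<noteq> [] \<and> hd p = u \<and> last p = v \<and> set p \<subseteq> verts G \<and> successively (adj G) p"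
  by (auto simp: walk_def successively_conv_nth)

lemma walk_rev: "walk G u p v \<Longrightarrow> walk G v (rev p) u"
  by (auto simp: walk_iff_successively hd_rev last_rev insert_commute)

lemma walk_append: "walk G u (p @ [v]) v \<Longrightarrow> walk G v (v # q) w \<Longrightarrow> walk G u (p @ v # q) w"
  by (auto simp: walk_iff_successively successively_append_iff hd_append split: if_splits)

lemma walk_prefix: "walk G u (p @ x # q) v \<Longrightarrow> walk G u (p @ [x]) x"
  by (auto simp: walk_iff_successively successively_append_iff hd_append)

lemma walk_suffix: "walk G u (p @ x # q) v \<Longrightarrow> walk G x (x # q) v"
  by (auto simp: walk_iff_successively successively_append_iff)

text \<open>In \<open>enat\<close> the infimum of a nonempty set is attained and that of the empty
  set is infinite, so a finite bound always has a witnessing walk. A list of \<open>Suc d\<close>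
  vertices makes \<open>d\<close> steps.\<close>

lemma gdist_le_iff: "gdist G u v \<le> enat d \<longleftrightarrow> (\<exists>p. walk G u p v \<and> length p \<le> Suc d)"
proof
  assume le: "gdist G u v \<le> enat d"
  let ?A = "(\<lambda>p. enat (length p - 1)) ` {p. walk G u p v}"
  have "?A \<noteq> {}"
    using le by (auto simp: gdist_def top_enat_def simp del: image_is_empty)
  then have "Inf ?A \<in> ?A"
    unfolding Inf_enat_def by (metis (mono_tags) LeastI ex_in_conv)
  then obtain p where "walk G u p v" "gdist G u v = enat (length p - 1)"
    by (auto simp: gdist_def)
  then show "\<exists>p. walk G u p v \<and> length p \<le> Suc d"
    using le by (intro exI[of _ p]) auto
next
  assume "\<exists>p. walk G u p v \<and> length p \<le> Suc d"
  then obtain p where "walk G u p v" "length p \<le> Suc d" by blast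
  then show "gdist G u v \<le> enat d"
    unfolding gdist_def by (intro INF_lower2[of p]) auto
qed

lemma gdist_le_commute: "gdist G u v \<le> enat d \<Longrightarrow> gdist G v u \<le> enat d"
  unfolding gdist_le_iff by (metis walk_rev length_rev)

lemma gdist_le_trans:
  assumes "gdist G u v \<le> enat a" "gdist G v w \<le> enat b"
  shows "gdist G u w \<le> enat (a + b)"
proof -
  obtain p q where p: "walk G u p v" "length p \<le> Suc a" and q: "walk G v q w" "length q \<le> Suc b"
    using assms by (auto simp: gdist_le_iff)
  obtain p' where p': "p = p' @ [v]"
    using p(1) by (metis walk_def append_butlast_last_id)
  obtain q' where q': "q = v # q'"
    using q(1) by (metis walk_def list.collapse)
  have "walk G u (p' @ v # q') w"
    using p q unfolding p' q' by (blast intro: walk_append)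
  moreover have "length (p' @ v # q') \<le> Suc (a + b)"
    using p q unfolding p' q' by simp
  ultimately show ?thesis
    unfolding gdist_le_iff by blast
qed

section \<open>Fans and weak reachability\<close>

text \<open>The element found for the whole of \<open>V\<close> goes on top, and ranking the rest
  cannot disturb it, as \<open>P\<close> sees the smaller elements only as a set.\<close>

lemma elimination_ranking:
  assumes "finite V" and "\<And>S. S \<subseteq> V \<Longrightarrow> S \<noteq> {} \<Longrightarrow> \<exists>v\<in>S. P v (S - {v})"
  shows "\<exists>f :: 'a \<Rightarrow> nat. inj_on f V \<and> (\<forall>v\<in>V. P v {u\<in>V. f u < f v})"
  using assms
proof (induction V rule: finite_psubset_induct)
  case (psubset V)
  show ?case
  proof (cases "V = {}")
    case False
    then obtain v where v: "v \<in> V" "P v (V - {v})"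
      using psubset.prems by blast
    then have "V - {v} \<subset> V" by blast
    then have "\<exists>f :: 'a \<Rightarrow> nat. inj_on f (V - {v}) \<and>
        (\<forall>w\<in>V - {v}. P w {u \<in> V - {v}. f u < f w})"
    proof (rule psubset.IH)
      fix S assume "S \<subseteq> V - {v}" "S \<noteq> {}"
      then show "\<exists>v\<in>S. P v (S - {v})"
        by (intro psubset.prems) auto
    qed
    then obtain f :: "'a \<Rightarrow> nat" where f: "inj_on f (V - {v})"
      and Pf: "\<And>w. w \<in> V - {v} \<Longrightarrow> P w {u \<in> V - {v}. f u < f w}"
      by blast
    \<comment> \<open>One more than the sum of the other values exceeds each of them.\<close>
    define g where "g = f(v := Suc (\<Sum>u\<in>V - {v}. f u))"
    have less: "g u < g v" if "u \<in> V - {v}" for u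
      using that member_le_sum[of u "V - {v}" f] psubset.hyps by (auto simp: g_def)
    have "inj_on g V"
    proof (rule inj_onI)
      fix x y assume xy: "x \<in> V" "y \<in> V" "g x = g y"
      then have "x = v \<longleftrightarrow> y = v"
        using less by fastforce
      then show "x = y"
        using xy f(1) by (auto simp: g_def inj_on_def split: if_splits)
    qed
    moreover have "P w {u \<in> V. g u < g w}" if "w \<in> V" for w
    proof (cases "w = v")
      case True
      have "{u \<in> V. g u < g v} = V - {v}"
        using less by blast
      then show ?thesis using True v by simp
    next
      case False
      have "{u \<in> V. g u < g w} = {u \<in> V - {v}. f u < f w}"
        using less[of w] False that by (auto simp: g_def)
      then show ?thesis using Pf[of w] False that by simp
    qed
    ultimately show ?thesis by blast
  qed auto
qed

text \<open>The start \<open>v\<close> is left out of \<open>q\<close>, so the paths of a fan are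
  disjoint without exception and \<open>length q\<close> counts steps. Vertices of \<open>q\<close>
  before the last may lie in \<open>S\<close> and may repeat.\<close>

definition fan_path :: "'a graph \<Rightarrow> nat \<Rightarrow> 'a \<Rightarrow> 'a set \<Rightarrow> 'a list \<Rightarrow> bool" where
  "fan_path G r v S q \<longleftrightarrow>
     q \<noteq> [] \<and> length q \<le> r \<and> v \<notin> set q \<and> walk G v (v # q) (last q) \<and> last q \<in> S"

text \<open>With \<open>S\<close> the set of vertices below \<open>v\<close>, the largest size of
  such a \<open>Q\<close> is the quantity bounded by the \<open>r\<close>-admissibility of an
  ordering.\<close>

definition fan :: "'a graph \<Rightarrow> nat \<Rightarrow> 'a \<Rightarrow> 'a set \<Rightarrow> 'a list set \<Rightarrow> bool" where
  "fan G r v S Q \<longleftrightarrow> (\<forall>q\<in>Q. fan_path G r v S q) \<and> disjoint_family_on set Q"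

definition wreach :: "'a graph \<Rightarrow> ('a \<Rightarrow> nat) \<Rightarrow> nat \<Rightarrow> 'a \<Rightarrow> 'a set" where
  "wreach G f i v = {u. \<exists>p. walk G v p u \<and> length p \<le> Suc i \<and> (\<forall>x\<in>set p. f u \<le> f x)}"

lemma finite_fan:
  assumes "finite (verts G)" "fan G r v S Q"
  shows "finite Q"
proof (rule finite_subset)
  show "Q \<subseteq> {q. set q \<subseteq> verts G \<and> length q \<le> r}"
    using assms by (auto simp: fan_def fan_path_def walk_def)
  show "finite {q. set q \<subseteq> verts G \<and> length q \<le> r}"
    by (rule finite_lists_length_le[OF assms(1)])
qed

text \<open>The bound \<open>k\<close> yields a fan of greatest size, and a path avoiding all its
  members could be added to it.\<close>

lemma maximal_fan:
  assumes bound: "\<And>Q. fan G r v S Q \<Longrightarrow> card Q \<le> k" and fin: "finite (verts G)"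
  shows "\<exists>Q. fan G r v S Q \<and> (\<forall>q. fan_path G r v S q \<longrightarrow> (\<exists>q'\<in>Q. set q \<inter> set q' \<noteq> {}))"
proof -
  have "fan G r v S {}" by (auto simp: fan_def disjoint_family_on_def)
  then have "\<exists>Q. fan G r v S Q \<and> (\<forall>Q'. fan G r v S Q' \<longrightarrow> card Q' \<le> card Q)"
    by (rule ex_has_greatest_nat[where b = "Suc k"]) (simp add: bound less_Suc_eq_le)
  then obtain Q where Q: "fan G r v S Q" and max: "\<And>Q'. fan G r v S Q' \<Longrightarrow> card Q' \<le> card Q"
    by auto
  have "\<exists>q'\<in>Q. set q \<inter> set q' \<noteq> {}" if q: "fan_path G r v S q" for q
  proof (rule ccontr)
    assume "\<not> ?thesis"
    then have disj: "\<forall>q'\<in>Q. set q \<inter> set q' = {}" by blast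
    then have "fan G r v S (insert q Q)"
      using Q q unfolding fan_def disjoint_family_on_def by blast
    moreover have "q \<notin> Q" using disj q by (auto simp: fan_path_def)
    ultimately show False
      using max[of "insert q Q"] finite_fan[OF fin Q] by simp
  qed
  then show ?thesis using Q by blast
qed

text \<open>A walk from \<open>v\<close> to a smaller weakly reachable \<open>u\<close> meets a maximal fan at some \<open>x\<close>, and \<open>u\<close> is
  still weakly reachable from \<open>x\<close> along the rest of the walk.\<close>

lemma card_wreach_le:
  assumes fin: "finite (verts G)" and inj: "inj_on f (verts G)"
    and fan: "\<And>v Q. v \<in> verts G \<Longrightarrow> fan G r v {u \<in> verts G. f u < f v} Q \<Longrightarrow> card Q \<le> k"
    and "i \<le> r" "v \<in> verts G"
  shows "card (wreach G f i v) \<le> (k * r + 1) ^ i"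
  using \<open>i \<le> r\<close> \<open>v \<in> verts G\<close>
proof (induction i arbitrary: v)
  case 0
  have "wreach G f 0 v \<subseteq> {v}"
    by (auto simp: wreach_def walk_def le_Suc_eq length_Suc_conv)
  then show ?case using card_mono[of "{v}"] by simp
next
  case (Suc i)
  obtain Q where Q: "fan G r v {u \<in> verts G. f u < f v} Q" and
    hit: "\<And>q. fan_path G r v {u \<in> verts G. f u < f v} q \<Longrightarrow> \<exists>q'\<in>Q. set q \<inter> set q' \<noteq> {}"
    using maximal_fan[of G r v "{u \<in> verts G. f u < f v}" k] fan[OF Suc.prems(2)] fin by auto
  define U where "U = (\<Union>q\<in>Q. set q)"
  have finQ: "finite Q" using finite_fan[OF fin Q] .
  have finU: "finite U" by (simp add: U_def finQ)
  have "card U \<le> (\<Sum>q\<in>Q. card (set q))"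
    unfolding U_def by (rule card_UN_le[OF finQ])
  also have "\<dots> \<le> (\<Sum>q\<in>Q. r)"
    using Q by (intro sum_mono) (auto simp: fan_def fan_path_def intro: order_trans[OF card_length])
  also have "\<dots> \<le> k * r"
    using fan[OF Suc.prems(2) Q] by simp
  finally have cardU: "card U \<le> k * r" .
  have UV: "U \<subseteq> verts G"
    using Q by (auto simp: U_def fan_def fan_path_def walk_def)
  have sub: "wreach G f (Suc i) v \<subseteq> insert v (\<Union>x\<in>U. wreach G f i x)"
  proof
    fix u assume "u \<in> wreach G f (Suc i) v"
    then obtain p where p: "walk G v p u" "length p \<le> Suc (Suc i)" "\<forall>x\<in>set p. f u \<le> f x"
      by (auto simp: wreach_def)
    show "u \<in> insert v (\<Union>x\<in>U. wreach G f i x)"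
    proof (cases "u = v")
      case False
      \<comment> \<open>Cutting at the last visit to \<open>v\<close> makes \<open>q\<close> avoid
        \<open>v\<close>, as a fan path must.\<close>
      have "v \<in> set p" using p by (auto simp: walk_def)
      then obtain a q where aq: "p = a @ v # q" "v \<notin> set q"
        using split_list_last by metis
      have q: "walk G v (v # q) u" using p(1) unfolding aq by (rule walk_suffix)
      then have "q \<noteq> []" "last q = u" using False by (auto simp: walk_def split: if_splits)
      have "f u \<noteq> f v" using inj False Suc.prems p(1)
        by (metis inj_onD last_in_set subsetD walk_def)
      then have "f u < f v" using p(3) aq by fastforce
      moreover have "u \<in> verts G" using p(1) by (auto simp: walk_def)
      moreover have "length q \<le> r" using p(2) aq Suc.prems by simp
      ultimately obtain q' where q': "q' \<in> Q" "set q \<inter> set q' \<noteq> {}"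
        using hit[of q] \<open>q \<noteq> []\<close> \<open>last q = u\<close> q aq(2) by (auto simp: fan_path_def)
      then obtain x where x: "x \<in> set q" "x \<in> U"
        by (auto simp: U_def)
      then obtain b c where bc: "q = b @ x # c" using split_list by metis
      have "walk G x (x # c) u"
        using q walk_suffix[of G v "v # b" x c u] unfolding bc by simp
      moreover have "length (x # c) \<le> Suc i" using p(2) aq bc by simp
      ultimately have "u \<in> wreach G f i x"
        using p(3) aq bc unfolding wreach_def by fastforce
      then show ?thesis using x by blast
    qed simp
  qed
  have "wreach G f i x \<subseteq> verts G" for x by (auto simp: wreach_def walk_def)
  then have "finite (wreach G f i x)" for x using fin finite_subset by blast
  then have "card (wreach G f (Suc i) v) \<le> card (insert v (\<Union>x\<in>U. wreach G f i x))"
    using finU by (intro card_mono[OF _ sub]) auto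
  also have "\<dots> \<le> Suc (card (\<Union>x\<in>U. wreach G f i x))"
    by (rule card_insert_le_m1) auto
  also have "\<dots> \<le> Suc (\<Sum>x\<in>U. card (wreach G f i x))"
    using card_UN_le[OF finU] by auto
  also have "\<dots> \<le> Suc (\<Sum>x\<in>U. (k * r + 1) ^ i)"
    unfolding Suc_le_mono using Suc.IH Suc.prems UV by (intro sum_mono) auto
  also have "\<dots> \<le> Suc (k * r * (k * r + 1) ^ i)"
    using cardU by simp
  \<comment> \<open>With M = \<open>k * r + 1\<close> the recursion gives 1 + (M - 1) * M^i, which
    is at most M^(i + 1) because M^i is at least 1.\<close>
  also have "\<dots> \<le> (k * r + 1) ^ Suc i" by simp
  finally show ?case .
qed

section \<open>Shallow minors\<close>

text \<open>The sets \<open>B x\<close> are the vertex sets of the contracted subgraphs, each indexed by its own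
  center \<open>x\<close>, and \<open>F\<close> is a set of edges of the contraction.\<close>

definition minor_sparse :: "nat \<Rightarrow> nat \<Rightarrow> 'a graph \<Rightarrow> bool" where
  "minor_sparse R b G \<longleftrightarrow>
     (\<forall>I B F. I \<subseteq> verts G \<longrightarrow>
        (\<forall>x\<in>I. x \<in> B x \<and> (\<forall>y\<in>B x. \<exists>p. walk G x p y \<and> set p \<subseteq> B x \<and> length p \<le> Suc R)) \<longrightarrow>
        disjoint_family_on B I \<longrightarrow>
        (\<forall>e\<in>F. \<exists>x\<in>I. \<exists>y\<in>I. e = {x, y} \<and> x \<noteq> y \<and> (\<exists>a\<in>B x. \<exists>c\<in>B y. adj G a c)) \<longrightarrow>
        card F \<le> b * card I)"

lemma bounded_expansion_minor_sparse:
  assumes fs: "\<And>G. G \<in> C \<Longrightarrow> fin_simple_graph G" and "bounded_expansion C"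
  shows "\<exists>b. \<forall>G\<in>C. minor_sparse R b G"
proof -
  obtain b :: real where b: "\<And>G M. G \<in> C \<Longrightarrow> depth_minor R M G \<Longrightarrow>
      real (card (edges M)) / real (card (verts M)) \<le> b"
    using assms(2) unfolding bounded_expansion_def by blast
  have "minor_sparse R (nat \<lceil>b\<rceil>) G" if G: "G \<in> C" for G
    unfolding minor_sparse_def
  proof (intro allI impI)
    fix I B F
    assume IV: "I \<subseteq> verts G" and
      B: "\<forall>x\<in>I. x \<in> B x \<and> (\<forall>y\<in>B x. \<exists>p. walk G x p y \<and> set p \<subseteq> B x \<and> length p \<le> Suc R)" and
      disj: "disjoint_family_on B I" and
      F: "\<forall>e\<in>F. \<exists>x\<in>I. \<exists>y\<in>I. e = {x, y} \<and> x \<noteq> y \<and> (\<exists>a\<in>B x. \<exists>c\<in>B y. adj G a c)"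
    have finV: "finite (verts G)" using fs[OF G] by (simp add: fin_simple_graph_def)
    then have finI: "finite I" using IV finite_subset by blast
    \<comment> \<open>Restricting to the union leaves no vertex outside the contracted subgraphs, so
      the contraction has exactly the sets \<open>B x\<close> as vertices and the ratio has
      denominator \<open>card I\<close>.\<close>
    define V where "V = (\<Union>x\<in>I. B x)"
    define G' where "G' = Graph V {e \<in> edges G. e \<subseteq> V}"
    define A where "A x = Graph (B x) {e \<in> edges G. e \<subseteq> B x}" for x
    have BV: "B x \<subseteq> verts G" if "x \<in> I" for x
      using bspec[OF B that] by (auto simp: walk_def dest!: bspec)
    have inj: "inj_on B I"
      using B disj unfolding inj_on_def disjoint_family_on_def by (metis IntI empty_iff)
    have from_center: "gdist (A x) x y \<le> enat R" if x: "x \<in> I" "y \<in> B x" for x y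
    proof -
      obtain p where "walk G x p y" "set p \<subseteq> B x" "length p \<le> Suc R"
        using bspec[OF B x(1)] x(2) by blast
      then have "walk (A x) x p y"
        unfolding walk_def A_def by auto
      then show ?thesis
        unfolding gdist_le_iff using \<open>length p \<le> Suc R\<close> by blast
    qed
    have "connected_graph (A x)" if "x \<in> I" for x
      unfolding connected_graph_def
    proof (intro conjI ballI)
      show "verts (A x) \<noteq> {}" using B that by (auto simp: A_def)
      fix u v assume "u \<in> verts (A x)" "v \<in> verts (A x)"
      then have "gdist (A x) u v \<le> enat (R + R)"
        using from_center that by (intro gdist_le_trans[of _ _ x] gdist_le_commute[of _ x]) (auto simp: A_def)
      then show "gdist (A x) u v \<noteq> \<infinity>"
        by (cases "gdist (A x) u v") auto
    qed
    moreover have "radius (A x) \<le> enat R" if "x \<in> I" for x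
      unfolding radius_def using from_center that B
      by (intro INF_lower2[of x] SUP_least) (auto simp: A_def)
    moreover have "subgraph (A x) G'" if "x \<in> I" for x
      using that unfolding subgraph_def A_def G'_def V_def by auto
    moreover have "subgraph G' G"
      using BV unfolding subgraph_def G'_def V_def by auto
    moreover have "pairwise (\<lambda>A B. disjnt (verts A) (verts B)) (A ` I)"
    proof (rule pairwiseI)
      fix X Y assume "X \<in> A ` I" "Y \<in> A ` I" "X \<noteq> Y"
      then obtain x y where "X = A x" "Y = A y" "x \<in> I" "y \<in> I" "x \<noteq> y" by blast
      then show "disjnt (verts X) (verts Y)"
        using disj by (simp add: disjnt_def A_def disjoint_family_on_def)
    qed
    ultimately have "depth_minor R (contract G' (A ` I)) G"
      unfolding depth_minor_def by (intro exI[of _ G'] exI[of _ "A ` I"]) simp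
    note bound = b[OF G this]
    have verts: "verts (contract G' (A ` I)) = B ` I"
      by (auto simp: contract_def Let_def image_image A_def G'_def V_def)
    have edges: "edges (contract G' (A ` I)) =
        {{X, Y} | X Y. X \<in> B ` I \<and> Y \<in> B ` I \<and> X \<noteq> Y \<and> (\<exists>x\<in>X. \<exists>y\<in>Y. adj G' x y)}"
      using verts by (simp add: contract_def Let_def)
    have "(`) B ` F \<subseteq> edges (contract G' (A ` I))"
    proof
      fix e assume "e \<in> (`) B ` F"
      then obtain x y a c where xy: "e = {B x, B y}" "x \<in> I" "y \<in> I" "x \<noteq> y"
        "a \<in> B x" "c \<in> B y" "adj G a c"
        using F by force
      then have "B x \<noteq> B y" using inj by (auto dest: inj_onD)
      moreover have "{a, c} \<in> edges G'"
        using xy by (auto simp: G'_def V_def)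
      ultimately show "e \<in> edges (contract G' (A ` I))"
        using xy unfolding edges by blast
    qed
    moreover have "edges (contract G' (A ` I)) \<subseteq> Pow (B ` I)"
      unfolding edges by blast
    then have "finite (edges (contract G' (A ` I)))"
      using finI finite_subset by blast
    ultimately have "card ((`) B ` F) \<le> card (edges (contract G' (A ` I)))"
      by (rule card_mono[rotated])
    moreover have "F \<subseteq> Pow I" using F by auto
    then have "inj_on ((`) B) F"
      using inj_on_image_Pow[OF inj] inj_on_subset by blast
    ultimately have cardF: "card F \<le> card (edges (contract G' (A ` I)))"
      by (simp add: card_image)
    show "card F \<le> nat \<lceil>b\<rceil> * card I"
    \<comment> \<open>For empty \<open>I\<close> the ratio is a division by zero and carries no
      information; \<open>F\<close> is then empty because its members have ends in
      \<open>I\<close>.\<close>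
    proof (cases "I = {}")
      case True
      then have "F = {}" using F by auto
      then show ?thesis by simp
    next
      case False
      then have pos: "0 < real (card I)" using finI by (simp add: card_gt_0_iff)
      have "real (card F) \<le> real (card (edges (contract G' (A ` I))))"
        using cardF by simp
      also have "\<dots> \<le> b * real (card I)"
        using bound pos by (simp add: verts card_image[OF inj] divide_le_eq)
      also have "\<dots> \<le> real (nat \<lceil>b\<rceil>) * real (card I)"
        by (intro mult_right_mono) linarith+
      finally show ?thesis
        by (metis of_nat_le_iff of_nat_mult)
    qed
  qed
  then show ?thesis by blast
qed

text \<open>The average degree is at most 2b, so at least half of \<open>S\<close> has degree at
  most 4b. A largest independent set among these vertices dominates them, each member accounting for
  at most 4b + 1.\<close>

lemma large_independent_set:
  fixes S :: "'a set"
  assumes fin: "finite S" and F: "\<And>e. e \<in> F \<Longrightarrow> \<exists>x\<in>S. \<exists>y\<in>S. e = {x, y} \<and> x \<noteq> y"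
    and cardF: "card F \<le> b * card S"
  shows "\<exists>I\<subseteq>S. (\<forall>x\<in>I. \<forall>y\<in>I. {x, y} \<notin> F) \<and> card S \<le> 2 * (4 * b + 1) * card I"
proof -
  define N where "N x = {y \<in> S. {x, y} \<in> F}" for x
  define L where "L = {x \<in> S. card (N x) \<le> 4 * b}"
  have finN: "finite (N x)" for x using fin by (simp add: N_def)
  have "F \<subseteq> Pow S" using F by blast
  then have finF: "finite F" using fin finite_subset by blast
  have "(\<Sum>x\<in>S. card (N x)) = card (Sigma S N)"
    using fin finN by simp
  also have "\<dots> \<le> card (\<Union>e\<in>F. {z. {fst z, snd z} = e})"
  proof (rule card_mono)
    show "finite (\<Union>e\<in>F. {z. {fst z, snd z} = e})"
      by (rule finite_subset[of _ "S \<times> S"]) (use \<open>F \<subseteq> Pow S\<close> fin in auto)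
  qed (auto simp: N_def)
  also have "\<dots> \<le> (\<Sum>e\<in>F. card {z. {fst z, snd z} = e})"
    by (rule card_UN_le[OF finF])
  also have "\<dots> \<le> (\<Sum>e\<in>F. 2)"
  proof (rule sum_mono)
    fix e assume "e \<in> F"
    then obtain x y where "e = {x, y}" using F by blast
    then have "{z. {fst z, snd z} = e} \<subseteq> {(x, y), (y, x)}"
      by (auto simp: doubleton_eq_iff)
    then have "card {z. {fst z, snd z} = e} \<le> card {(x, y), (y, x)}"
      by (intro card_mono) auto
    then show "card {z. {fst z, snd z} = e} \<le> 2"
      using card_2_iff[of "{(x, y), (y, x)}"] by (cases "x = y") auto
  qed
  finally have deg: "(\<Sum>x\<in>S. card (N x)) \<le> 2 * (b * card S)"
    using cardF by simp
  have "(4 * b + 1) * card (S - L) = (\<Sum>x\<in>S - L. 4 * b + 1)" by simp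
  also have "\<dots> \<le> (\<Sum>x\<in>S - L. card (N x))"
    by (rule sum_mono) (auto simp: L_def)
  also have "\<dots> \<le> (\<Sum>x\<in>S. card (N x))"
    using fin by (intro sum_mono2) auto
  also note deg
  \<comment> \<open>Doubling turns 2b into 4b, which is below the factor 4b + 1; this factor is
    positive even for \<open>b = 0\<close> and can be cancelled.\<close>
  finally have "(4 * b + 1) * (2 * card (S - L)) \<le> (4 * b + 1) * card S"
    by (simp add: algebra_simps)
  then have "2 * card (S - L) \<le> card S"
    by (simp only: mult_le_cancel1)
  moreover have "card S = card L + card (S - L)"
    using fin by (subst card_Un_disjoint[symmetric]) (auto simp: L_def intro: arg_cong[of _ _ card])
  ultimately have half: "card S \<le> 2 * card L" by simp
  have finL: "finite L" using fin by (simp add: L_def)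
  define ind where "ind I \<longleftrightarrow> I \<subseteq> L \<and> (\<forall>x\<in>I. \<forall>y\<in>I. {x, y} \<notin> F)" for I
  have "ind {}" by (simp add: ind_def)
  then have "\<exists>I. ind I \<and> (\<forall>J. ind J \<longrightarrow> card J \<le> card I)"
    by (rule ex_has_greatest_nat[where b = "Suc (card L)"])
      (simp add: ind_def card_mono finL less_Suc_eq_le)
  then obtain I where I: "ind I" and max: "\<And>J. ind J \<Longrightarrow> card J \<le> card I" by auto
  have finI: "finite I" using I finL finite_subset by (auto simp: ind_def)
  have "L \<subseteq> (\<Union>x\<in>I. insert x (N x))"
  proof
    fix x assume x: "x \<in> L"
    show "x \<in> (\<Union>x\<in>I. insert x (N x))"
    proof (rule ccontr)
      assume no: "\<not> ?thesis"
      then have "\<forall>y\<in>I. {x, y} \<notin> F \<and> {y, x} \<notin> F"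
        using x by (auto simp: N_def L_def insert_commute)
      moreover have "{x, x} \<notin> F" using F by fastforce
      ultimately have "ind (insert x I)"
        using I x unfolding ind_def by blast
      moreover have "x \<notin> I" using no by blast
      ultimately show False using max[of "insert x I"] finI by simp
    qed
  qed
  then have "card L \<le> card (\<Union>x\<in>I. insert x (N x))"
    using finI finN by (intro card_mono) auto
  also have "\<dots> \<le> (\<Sum>x\<in>I. card (insert x (N x)))"
    by (rule card_UN_le[OF finI])
  also have "\<dots> \<le> (\<Sum>x\<in>I. 4 * b + 1)"
    using I by (intro sum_mono) (auto simp: ind_def L_def card_insert_if finN)
  finally have "card L \<le> (4 * b + 1) * card I" by (simp add: mult.commute)
  then have "card S \<le> 2 * (4 * b + 1) * card I"
    using half by linarith
  moreover have "I \<subseteq> S" using I by (auto simp: ind_def L_def)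
  ultimately show ?thesis using I unfolding ind_def by blast
qed

text \<open>A maximal family of internally disjoint short paths between vertices of \<open>S\<close> has linear size,
  so some large \<open>I \<subseteq> S\<close> contains no pair of endpoints. By maximality, the initial segments of the
  fans from the vertices of \<open>I\<close>, cut off where they meet \<open>S\<close> or a path of the family, are disjoint;
  contracting them gives a minor in which every vertex of \<open>I\<close> has large degree.\<close>

lemma ex_small_fan:
  assumes fs: "fin_simple_graph G" and sparse: "minor_sparse (2 * r) b G"
    and S: "S \<subseteq> verts G" "S \<noteq> {}"
  shows "\<exists>v\<in>S. \<forall>Q. fan G r v (S - {v}) Q \<longrightarrow> card Q \<le> b * (1 + b * (2 * r)) * (2 * (4 * b + 1))"
    (is "\<exists>v\<in>S. \<forall>Q. _ \<longrightarrow> card Q \<le> ?K")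
proof (rule ccontr)
  assume "\<not> ?thesis"
  then have "\<forall>v\<in>S. \<exists>Q. fan G r v (S - {v}) Q \<and> ?K < card Q"
    by (auto simp: not_le)
  then obtain Q where Q: "\<And>v. v \<in> S \<Longrightarrow> fan G r v (S - {v}) (Q v)"
    and large: "\<And>v. v \<in> S \<Longrightarrow> ?K < card (Q v)"
    by (metis (no_types))
  have finV: "finite (verts G)" using fs by (simp add: fin_simple_graph_def)
  then have finS: "finite S" using S finite_subset by blast
  define ends :: "'a \<times> 'a list \<times> 'a \<Rightarrow> 'a set" where "ends = (\<lambda>(x, m, y). {x, y})"
  define inner :: "'a \<times> 'a list \<times> 'a \<Rightarrow> 'a set" where "inner = (\<lambda>(x, m, y). set m)"
  \<comment> \<open>The length \<open>2 * r\<close> leaves room for two segments of fewer than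
    \<open>r\<close> vertices glued at a common vertex, which is why minors of depth
    \<open>2 * r\<close> are considered.\<close>
  define link where "link = (\<lambda>(x, m, y). x \<in> S \<and> y \<in> S \<and> x \<noteq> y \<and>
    walk G x (x # m @ [y]) y \<and> set m \<inter> S = {} \<and> length m \<le> 2 * r)"
  \<comment> \<open>One path per unordered pair: by \<open>inj_on ends\<close>, the paths of a
    family give distinct edges of a minor on \<open>S\<close>.\<close>
  define pack where "pack P \<longleftrightarrow> (\<forall>t\<in>P. link t) \<and> disjoint_family_on inner P \<and> inj_on ends P" for P
  have ends_Pow: "ends ` P \<subseteq> Pow S" if "pack P" for P
    using that by (fastforce simp: pack_def link_def ends_def)
  have card_pack: "card P < Suc (card (Pow S))" if "pack P" for P
    using that ends_Pow[OF that] finS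
    by (metis card_image card_mono finite_Pow_iff less_Suc_eq_le pack_def)
  have "pack {}" by (simp add: pack_def disjoint_family_on_def)
  then have "\<exists>P. pack P \<and> (\<forall>P'. pack P' \<longrightarrow> card P' \<le> card P)"
    by (rule ex_has_greatest_nat[where b = "Suc (card (Pow S))"]) (use card_pack in blast)
  then obtain P where P: "pack P" and max: "\<And>P'. pack P' \<Longrightarrow> card P' \<le> card P" by auto
  have finP: "finite P"
    using P ends_Pow[OF P] finS by (meson finite_Pow_iff inj_on_finite pack_def)

  \<comment> \<open>Each path is absorbed by its first end, so its last edge becomes the edge of the
    minor between the two ends.\<close>
  define B where "B x = insert x (\<Union>t\<in>{t\<in>P. fst t = x}. inner t)" for x
  have inner_S: "inner t \<inter> S = {}" if "t \<in> P" for t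
    using P that by (auto simp: pack_def link_def inner_def)
  have inner_disj: "inner t \<inter> inner t' = {}" if "t \<in> P" "t' \<in> P" "t \<noteq> t'" for t t'
    using P that by (auto simp: pack_def disjoint_family_on_def)
  have "card (ends ` P) \<le> b * card S"
  proof (rule sparse[unfolded minor_sparse_def, rule_format])
    show "disjoint_family_on B S"
      unfolding disjoint_family_on_def
    proof (intro ballI impI)
      fix x y assume xy: "x \<in> S" "y \<in> S" "x \<noteq> y"
      show "B x \<inter> B y = {}"
      proof (rule ccontr)
        assume "B x \<inter> B y \<noteq> {}"
        then obtain z where "z \<in> B x" "z \<in> B y" by blast
        then have "z = x \<or> (\<exists>t\<in>P. fst t = x \<and> z \<in> inner t)"
          "z = y \<or> (\<exists>t\<in>P. fst t = y \<and> z \<in> inner t)"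
          unfolding B_def by blast+
        then show False
          using xy inner_S inner_disj by (metis IntI empty_iff)
      qed
    qed
  next
    fix x assume "x \<in> S"
    have "\<exists>p. walk G x p z \<and> set p \<subseteq> B x \<and> length p \<le> Suc (2 * r)" if z: "z \<in> B x" for z
    proof (cases "z = x")
      case True
      then show ?thesis using \<open>x \<in> S\<close> S
        by (intro exI[of _ "[x]"]) (auto simp: walk_def B_def)
    next
      case False
      then obtain m y where m: "(x, m, y) \<in> P" "z \<in> set m"
        using z by (auto simp: B_def inner_def)
      then obtain a c where ac: "m = a @ z # c" using split_list by metis
      have lk: "link (x, m, y)" using m P by (auto simp: pack_def)
      then have "walk G x ((x # a) @ [z]) z"
        using walk_prefix[of G x "x # a" z "c @ [y]" y] by (auto simp: link_def ac)
      moreover have "set ((x # a) @ [z]) \<subseteq> B x"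
        using m(1) ac by (fastforce simp: B_def inner_def)
      moreover have "length ((x # a) @ [z]) \<le> Suc (2 * r)"
        using lk by (auto simp: link_def ac)
      ultimately show ?thesis by blast
    qed
    then show "x \<in> B x \<and> (\<forall>y\<in>B x. \<exists>p. walk G x p y \<and> set p \<subseteq> B x \<and> length p \<le> Suc (2 * r))"
      by (simp add: B_def)
  next
    fix e assume "e \<in> ends ` P"
    then obtain x m y where t: "(x, m, y) \<in> P" "e = {x, y}" by (auto simp: ends_def)
    then have lk: "link (x, m, y)" using P by (auto simp: pack_def)
    then have "adj G (last (x # m)) y"
      by (auto simp: link_def walk_iff_successively successively_append_iff successively_Cons split: if_splits)
    moreover have "last (x # m) \<in> B x"
      using t(1) by (fastforce simp: B_def inner_def)
    moreover have "y \<in> B y" by (simp add: B_def)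
    ultimately show "\<exists>x\<in>S. \<exists>y\<in>S. e = {x, y} \<and> x \<noteq> y \<and> (\<exists>a\<in>B x. \<exists>c\<in>B y. adj G a c)"
      using lk t(2) by (auto simp: link_def simp del: last.simps)
  qed (rule S)
  moreover have "\<exists>x\<in>S. \<exists>y\<in>S. e = {x, y} \<and> x \<noteq> y" if "e \<in> ends ` P" for e
    using that P by (fastforce simp: pack_def link_def ends_def)
  ultimately obtain I where IS: "I \<subseteq> S" and indep: "\<And>x y. x \<in> I \<Longrightarrow> y \<in> I \<Longrightarrow> {x, y} \<notin> ends ` P"
    and cardI: "card S \<le> 2 * (4 * b + 1) * card I"
    using large_independent_set[OF finS, of "ends ` P" b] by metis
  have finI: "finite I" using IS finS finite_subset by blast
  have cardP: "card P \<le> b * card S"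
    using \<open>card (ends ` P) \<le> b * card S\<close> P by (simp add: pack_def card_image)

  define T where "T = S \<union> (\<Union>t\<in>P. inner t)"
  have TV: "T \<subseteq> verts G"
    using P S by (force simp: T_def pack_def link_def inner_def walk_def)
  then have finT: "finite T" using finV finite_subset by blast
  \<comment> \<open>The ends of such a walk are not yet joined by a path in \<open>P\<close>, and
    avoiding \<open>T\<close> keeps it off \<open>S\<close> and off all packed interiors, so it
    could be added to \<open>P\<close>.\<close>
  have no_link: False
    if "v \<in> I" "w \<in> I" "v \<noteq> w" "walk G v (v # m @ [w]) w" "set m \<inter> T = {}" "length m \<le> 2 * r" for v w m
  proof -
    have "link (v, m, w)" using that IS by (auto simp: link_def T_def)
    moreover have new: "ends (v, m, w) \<notin> ends ` P"
      using indep[OF that(1,2)] by (simp add: ends_def)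
    moreover have "inner (v, m, w) \<inter> inner t = {}" if "t \<in> P" for t
      using that \<open>set m \<inter> T = {}\<close> by (auto simp: inner_def T_def)
    ultimately have "pack (insert (v, m, w) P)"
      using P unfolding pack_def disjoint_family_on_def by (auto simp: Int_commute)
    then have "card (insert (v, m, w) P) \<le> card P" by (rule max)
    moreover have "(v, m, w) \<notin> P" using new by blast
    ultimately show False using finP by simp
  qed

  \<comment> \<open>The cut point exists because a fan path ends in \<open>S\<close>, which is part
    of \<open>T\<close>.\<close>
  define seg where "seg q = takeWhile (\<lambda>x. x \<notin> T) q" for q
  define tgt where "tgt q = hd (dropWhile (\<lambda>x. x \<notin> T) q)" for q
  have path: "fan_path G r v (S - {v}) q" if "v \<in> I" "q \<in> Q v" for v q
    using Q[of v] that IS by (auto simp: fan_def)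
  have seg: "tgt q \<in> T" "\<exists>c. q = seg q @ tgt q # c" "set (seg q) \<inter> T = {}"
    if "v \<in> I" "q \<in> Q v" for v q
  proof -
    have "last q \<in> T" "last q \<in> set q" using path[OF that] by (auto simp: fan_path_def T_def)
    then have ne: "dropWhile (\<lambda>x. x \<notin> T) q \<noteq> []" by (auto simp: dropWhile_eq_Nil_conv)
    then show "tgt q \<in> T" using hd_dropWhile[OF ne] by (simp add: tgt_def)
    show "\<exists>c. q = seg q @ tgt q # c"
      using ne by (metis list.collapse seg_def takeWhile_dropWhile_id tgt_def)
    show "set (seg q) \<inter> T = {}" by (auto simp: seg_def dest: set_takeWhileD)
  qed
  have initial: "walk G v (v # a @ [x]) x \<and> length a < r" if "v \<in> I" "q \<in> Q v" "q = a @ x # c" for v q a x c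
    using path[OF that(1,2)] walk_prefix[of G v "v # a" x c "last q"] that(3)
    by (auto simp: fan_path_def)
  \<comment> \<open>A target in \<open>I\<close> would make the segment a link. Hence an edge
    \<open>{v, tgt q}\<close> has \<open>v\<close> as its only end in \<open>I\<close>.\<close>
  have tgt: "tgt q \<notin> I" if v: "v \<in> I" "q \<in> Q v" for v q
  proof
    assume t: "tgt q \<in> I"
    obtain c where c: "q = seg q @ tgt q # c" using seg(2)[OF v] by blast
    then have "tgt q \<in> set q" by (metis in_set_conv_decomp)
    then have "v \<noteq> tgt q" using path[OF v] by (auto simp: fan_path_def)
    then show False
      using no_link[OF v(1) t, of "seg q"] initial[OF v c] seg(3)[OF v] by simp
  qed
  \<comment> \<open>Following one segment to a common vertex and the other one back would give a
    link.\<close>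
  have seg_disj: "set (seg q) \<inter> set (seg q') = {}"
    if v: "v \<in> I" "q \<in> Q v" and w: "w \<in> I" "q' \<in> Q w" and "v \<noteq> w" for v q w q'
  proof (rule ccontr)
    assume "\<not> ?thesis"
    then obtain x where x: "x \<in> set (seg q)" "x \<in> set (seg q')" by blast
    obtain a c where a: "seg q = a @ x # c" using x split_list by metis
    obtain a' c' where a': "seg q' = a' @ x # c'" using x split_list by metis
    have wa: "walk G v ((v # a) @ [x]) x" "length a < r"
      using initial[OF v, of a x] seg(2)[OF v] a by auto
    have "walk G w (w # a' @ [x]) x" and l': "length a' < r"
      using initial[OF w, of a' x] seg(2)[OF w] a' by auto
    then have "walk G x (x # rev a' @ [w]) w"
      using walk_rev by fastforce
    from walk_append[OF wa(1) this]
    have "walk G v (v # (a @ x # rev a') @ [w]) w" by simp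
    moreover have "set (a @ x # rev a') \<inter> T = {}"
      using seg(3)[OF v] seg(3)[OF w] a a' by auto
    moreover have "length (a @ x # rev a') \<le> 2 * r"
      using wa(2) l' by simp
    ultimately show False
      by (rule no_link[OF v(1) w(1) \<open>v \<noteq> w\<close>])
  qed

  \<comment> \<open>Only vertices of \<open>I\<close> absorb their segments; all targets stay single
    vertices.\<close>
  define D where "D z = (if z \<in> I then insert z (\<Union>q\<in>Q z. set (seg q)) else {z})" for z
  define F where "F = (\<lambda>(v, q). {v, tgt q}) ` Sigma I Q"
  have "card F \<le> b * card T"
  proof (rule sparse[unfolded minor_sparse_def, rule_format])
    show "disjoint_family_on D T"
      unfolding disjoint_family_on_def
    proof (intro ballI impI)
      fix x y assume xy: "x \<in> T" "y \<in> T" "x \<noteq> y"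
      show "D x \<inter> D y = {}"
      proof (rule ccontr)
        assume "D x \<inter> D y \<noteq> {}"
        then obtain z where "z \<in> D x" "z \<in> D y" by blast
        then have "z = x \<or> (x \<in> I \<and> (\<exists>q\<in>Q x. z \<in> set (seg q)))"
          "z = y \<or> (y \<in> I \<and> (\<exists>q\<in>Q y. z \<in> set (seg q)))"
          unfolding D_def by (auto split: if_splits)
        then show False
          using xy seg(3) seg_disj by (metis IntI empty_iff)
      qed
    qed
  next
    fix x assume "x \<in> T"
    have "\<exists>p. walk G x p z \<and> set p \<subseteq> D x \<and> length p \<le> Suc (2 * r)" if z: "z \<in> D x" for z
    proof (cases "z = x")
      case True
      then show ?thesis using \<open>x \<in> T\<close> TV
        by (intro exI[of _ "[x]"]) (auto simp: walk_def D_def)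
    next
      case False
      then obtain q where q: "x \<in> I" "q \<in> Q x" "z \<in> set (seg q)"
        using z by (auto simp: D_def split: if_splits)
      then obtain a c where a: "seg q = a @ z # c" using split_list by metis
      have "walk G x (x # a @ [z]) z" "length a < r"
        using initial[OF q(1,2), of a z] seg(2)[OF q(1,2)] a by auto
      moreover have "set (x # a @ [z]) \<subseteq> D x"
        using q a by (force simp: D_def)
      ultimately show ?thesis by (intro exI[of _ "x # a @ [z]"]) auto
    qed
    then show "x \<in> D x \<and> (\<forall>y\<in>D x. \<exists>p. walk G x p y \<and> set p \<subseteq> D x \<and> length p \<le> Suc (2 * r))"
      by (simp add: D_def)
  next
    fix e assume "e \<in> F"
    then obtain v q where e: "e = {v, tgt q}" and v: "v \<in> I" "q \<in> Q v" by (auto simp: F_def)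
    obtain c where "q = seg q @ tgt q # c" using seg(2)[OF v] by blast
    then have "walk G v (v # seg q @ [tgt q]) (tgt q)"
      using initial[OF v] by blast
    then have "adj G (last (v # seg q)) (tgt q)"
      by (auto simp: walk_iff_successively successively_append_iff successively_Cons split: if_splits)
    moreover have "last (v # seg q) \<in> D v"
    proof (cases "seg q = []")
      case False
      then have "last (seg q) \<in> (\<Union>q\<in>Q v. set (seg q))"
        using v last_in_set by blast
      then show ?thesis using v False by (simp add: D_def)
    qed (use v in \<open>simp add: D_def\<close>)
    moreover have "tgt q \<in> D (tgt q)" by (simp add: D_def)
    moreover have "v \<noteq> tgt q" using tgt[OF v] v by auto
    ultimately show "\<exists>x\<in>T. \<exists>y\<in>T. e = {x, y} \<and> x \<noteq> y \<and> (\<exists>a\<in>D x. \<exists>c\<in>D y. adj G a c)"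
      using e v seg(1)[OF v] IS unfolding T_def by blast
  qed (rule TV)
  \<comment> \<open>The end in \<open>I\<close> determines the fan, and disjointness of its paths
    makes their targets distinct, so every fan path counts as a separate edge of
    \<open>F\<close>.\<close>
  moreover have "inj_on (\<lambda>(v, q). {v, tgt q}) (Sigma I Q)"
  proof (rule inj_onI, clarify)
    fix v q w q'
    assume v: "v \<in> I" "q \<in> Q v" and w: "w \<in> I" "q' \<in> Q w" and eq: "{v, tgt q} = {w, tgt q'}"
    then have vw: "v = w" "tgt q = tgt q'"
      using tgt[OF v] tgt[OF w] by (auto simp: doubleton_eq_iff)
    have "tgt q \<in> set q" "tgt q' \<in> set q'"
      using seg(2)[OF v] seg(2)[OF w] by (metis in_set_conv_decomp)+
    then have "q = q'"
      using vw v w Q[of v] IS unfolding fan_def disjoint_family_on_def by (metis IntI empty_iff subsetD)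
    then show "v = w \<and> q = q'" using vw by simp
  qed
  moreover have "finite (Q v)" if "v \<in> I" for v
    using finite_fan[OF finV Q] that IS by blast
  ultimately have "(\<Sum>v\<in>I. card (Q v)) \<le> b * card T"
    using finI by (simp add: F_def card_image)
  moreover have "(\<Sum>v\<in>I. ?K + 1) \<le> (\<Sum>v\<in>I. card (Q v))"
    using large IS by (intro sum_mono) (auto simp: Suc_le_eq)
  \<comment> \<open>The factors of \<open>?K\<close> are the density \<open>b\<close>, a bound for
    \<open>card T\<close> relative to \<open>card S\<close>, and one for \<open>card S\<close>
    relative to \<open>card I\<close>; the surplus 1 gives the contradiction.\<close>
  ultimately have "(?K + 1) * card I \<le> b * card T" by (simp add: mult.commute)
  also have "card T \<le> card S + card (\<Union>t\<in>P. inner t)"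
    unfolding T_def by (rule card_Un_le)
  also have "card (\<Union>t\<in>P. inner t) \<le> (\<Sum>t\<in>P. card (inner t))"
    by (rule card_UN_le[OF finP])
  also have "\<dots> \<le> (\<Sum>t\<in>P. 2 * r)"
    using P by (intro sum_mono) (auto simp: pack_def link_def inner_def intro: order_trans[OF card_length])
  also have "\<dots> \<le> b * card S * (2 * r)"
    using cardP by simp
  finally have "(?K + 1) * card I \<le> b * (1 + b * (2 * r)) * card S"
    by (simp add: algebra_simps)
  also have "\<dots> \<le> b * (1 + b * (2 * r)) * (2 * (4 * b + 1) * card I)"
    using cardI by (rule mult_le_mono2)
  finally have "(?K + 1) * card I \<le> ?K * card I" by (simp only: mult.assoc)
  then have "card I = 0" by simp
  then have "card S = 0" using cardI by simp
  then show False using S finS by simp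
qed

section \<open>Coloring numbers\<close>

lemma finite_col_ords:
  assumes "finite (verts H)"
  shows "finite {col_ord H \<sigma> | \<sigma>. linear_order_on (verts H) \<sigma>}"
proof -
  have "{\<sigma>. linear_order_on (verts H) \<sigma>} \<subseteq> Pow (verts H \<times> verts H)"
    by (auto simp: order_on_defs)
  then have "finite {\<sigma>. linear_order_on (verts H) \<sigma>}"
    using assms finite_subset by blast
  then show ?thesis by simp
qed

lemma linear_order_on_ranking:
  fixes f :: "'a \<Rightarrow> nat"
  assumes "inj_on f V"
  shows "linear_order_on V {(u, v). u \<in> V \<and> v \<in> V \<and> f u \<le> f v}"
  using assms
  by (auto simp: order_on_defs refl_on_def trans_def antisym_def total_on_def inj_on_def)

text \<open>Degeneracy turned into an ordering: a vertex of small degree in the remaining set is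
  ranked above the rest of that set, so its smaller neighbors are among those few.\<close>

lemma col_le:
  assumes fs: "fin_simple_graph H"
    and deg: "\<And>W. W \<subseteq> verts H \<Longrightarrow> W \<noteq> {} \<Longrightarrow> \<exists>v\<in>W. card {u \<in> W. adj H v u} \<le> D"
  shows "col H \<le> D + 1"
proof -
  have fin: "finite (verts H)" using fs by (simp add: fin_simple_graph_def)
  have no_loop: "\<not> adj H v v" for v
    using fs by (auto simp: fin_simple_graph_def)
  have "\<exists>v\<in>S. card {u \<in> S - {v}. adj H v u} \<le> D" if S: "S \<subseteq> verts H" "S \<noteq> {}" for S
  proof -
    have "{u \<in> S - {v}. adj H v u} = {u \<in> S. adj H v u}" for v
      using no_loop by auto
    then show ?thesis using deg[OF S] by simp
  qed
  from elimination_ranking[of "verts H" "\<lambda>v S. card {u \<in> S. adj H v u} \<le> D", OF fin this]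
  obtain f :: "'a \<Rightarrow> nat" where inj: "inj_on f (verts H)"
    and f: "\<And>v. v \<in> verts H \<Longrightarrow> card {u \<in> {u \<in> verts H. f u < f v}. adj H v u} \<le> D"
    by auto
  define \<sigma> where "\<sigma> = {(u, v). u \<in> verts H \<and> v \<in> verts H \<and> f u \<le> f v}"
  have "linear_order_on (verts H) \<sigma>"
    unfolding \<sigma>_def by (rule linear_order_on_ranking[OF inj])
  then have "col H \<le> col_ord H \<sigma>"
    unfolding col_def by (intro Min_le finite_col_ords fin) auto
  also have "\<dots> \<le> D + 1"
  proof (cases "verts H = {}")
    case False
    have "card {v. {u, v} \<in> edges H \<and> (v, u) \<in> \<sigma> \<and> v \<noteq> u} \<le> D" if "u \<in> verts H" for u
    proof -
      have "{v. {u, v} \<in> edges H \<and> (v, u) \<in> \<sigma> \<and> v \<noteq> u} \<subseteq> {w \<in> {w \<in> verts H. f w < f u}. adj H u w}"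
      proof
        fix w assume "w \<in> {v. {u, v} \<in> edges H \<and> (v, u) \<in> \<sigma> \<and> v \<noteq> u}"
        then show "w \<in> {w \<in> {w \<in> verts H. f w < f u}. adj H u w}"
          using inj_onD[OF inj, of w u] by (auto simp: \<sigma>_def le_less)
      qed
      then show ?thesis
        by (intro order_trans[OF card_mono f[OF that]]) (use fin in auto)
    qed
    then show ?thesis
      using False fin by (simp add: col_ord_def)
  qed (simp add: col_ord_def)
  finally show ?thesis .
qed

text \<open>A clique needs pairwise distinct colors. The given coloring guarantees that the
  \<open>LEAST\<close> is attained.\<close>

lemma clique_number_le_chromatic_number:
  assumes "proper_coloring H k f"
  shows "clique_number H \<le> chromatic_number H"
proof -
  define n where "n = chromatic_number H"
  have "\<exists>f. proper_coloring H n f"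
    unfolding n_def chromatic_number_def by (rule LeastI_ex) (use assms in blast)
  then obtain g where g: "proper_coloring H n g" by blast
  have card: "card K \<le> n" if "clique H K" for K
  proof -
    have "inj_on g K"
      using that g unfolding clique_def proper_coloring_def inj_on_def by blast
    moreover have "g ` K \<subseteq> {..<n}"
      using that g by (auto simp: clique_def proper_coloring_def)
    ultimately have "card K \<le> card {..<n}"
      by (intro card_inj_on_le) auto
    then show ?thesis by simp
  qed
  have "{card K | K. clique H K} \<subseteq> {..n}" using card by auto
  then have "finite {card K | K. clique H K}" by (rule finite_subset) simp
  moreover have "clique H {}" by (simp add: clique_def)
  ultimately have "clique_number H \<le> n"
    unfolding clique_number_def using card by (subst Max_le_iff) auto
  then show ?thesis by (simp add: n_def)
qed

lemma card_clique_le_clique_number: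
  assumes "finite (verts H)" "clique H K"
  shows "card K \<le> clique_number H"
  unfolding clique_number_def
proof (rule Max_ge)
  have "{K. clique H K} \<subseteq> Pow (verts H)" by (auto simp: clique_def)
  then have "finite {K. clique H K}" using assms(1) finite_subset by blast
  then show "finite {card K | K. clique H K}" by simp
qed (use assms(2) in blast)

text \<open>Greedy coloring along an optimal ordering: each vertex takes the least color missing on
  its smaller neighbors, of which there are fewer than \<open>col H\<close>.\<close>

lemma proper_coloring_col:
  assumes fs: "fin_simple_graph H"
  shows "\<exists>g. proper_coloring H (col H) g"
proof -
  have fin: "finite (verts H)" using fs by (simp add: fin_simple_graph_def)
  have "\<exists>f :: 'a \<Rightarrow> nat. inj_on f (verts H)"
    using finite_imp_inj_to_nat_seg[OF fin] by blast
  then have "{col_ord H \<sigma> | \<sigma>. linear_order_on (verts H) \<sigma>} \<noteq> {}"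
    using linear_order_on_ranking by blast
  then have "col H \<in> {col_ord H \<sigma> | \<sigma>. linear_order_on (verts H) \<sigma>}"
    unfolding col_def by (intro Min_in finite_col_ords fin)
  then obtain \<sigma> where \<sigma>: "linear_order_on (verts H) \<sigma>" "col H = col_ord H \<sigma>" by blast
  define N where "N u = {v. {u, v} \<in> edges H \<and> (v, u) \<in> \<sigma> \<and> v \<noteq> u}" for u
  have NV: "N u \<subseteq> verts H" for u
    using fs by (auto simp: N_def fin_simple_graph_def)
  have N: "card (N u) < col H" if "u \<in> verts H" for u
    using that fin unfolding \<sigma>(2) col_ord_def N_def by (auto simp: less_Suc_eq_le)
  have sub: "\<sigma> \<subseteq> verts H \<times> verts H" and total: "total_on (verts H) \<sigma>"
    and "trans \<sigma>" "antisym \<sigma>" using \<sigma>(1) by (auto simp: order_on_defs)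
  have "finite \<sigma>" using sub fin finite_subset by blast
  moreover have "acyclic (\<sigma> - Id)"
    using \<open>trans \<sigma>\<close> \<open>antisym \<sigma>\<close> by (simp add: acyclic_def trans_diff_Id trancl_id)
  ultimately have wf: "wf (\<sigma> - Id)" by (intro finite_acyclic_wf) auto
  \<comment> \<open>The recursion reads \<open>g\<close> only on \<open>N u\<close>, whose members
    strictly precede \<open>u\<close>, so \<open>cut\<close> changes nothing there.\<close>
  define g where "g = wfrec (\<sigma> - Id) (\<lambda>(g :: 'a \<Rightarrow> nat) u. LEAST k. k \<notin> g ` N u)"
  have g: "g u = (LEAST k. k \<notin> g ` N u)" for u
  proof -
    have "cut g (\<sigma> - Id) u ` N u = g ` N u"
      by (intro image_cong) (auto simp: cut_def N_def)
    moreover have "g u = (LEAST k. k \<notin> cut g (\<sigma> - Id) u ` N u)"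
      unfolding g_def by (rule wfrec[OF wf])
    ultimately show ?thesis by simp
  qed
  have free: "\<exists>k \<le> card (N u). k \<notin> g ` N u" for u
  proof (rule ccontr)
    assume "\<not> ?thesis"
    then have sub: "{..card (N u)} \<subseteq> g ` N u" by auto
    have fin_N: "finite (N u)" using NV fin by (rule finite_subset)
    have "card {..card (N u)} \<le> card (g ` N u)"
      using fin_N by (intro card_mono sub) simp
    also have "\<dots> \<le> card (N u)"
      using fin_N by (rule card_image_le)
    finally show False by simp
  qed
  have new: "g u \<notin> g ` N u" for u
    using free[of u] by (subst g) (rule LeastI_ex[of "\<lambda>k. k \<notin> g ` N u"], blast)
  have "g u < col H" if "u \<in> verts H" for u
  proof -
    obtain k where "k \<le> card (N u)" "k \<notin> g ` N u" using free by blast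
    then have "g u \<le> card (N u)"
      by (subst g) (rule order_trans[OF Least_le])
    then show ?thesis using N[OF that] by simp
  qed
  moreover have "g u \<noteq> g v" if "u \<in> verts H" "v \<in> verts H" "{u, v} \<in> edges H" for u v
  proof -
    have "u \<noteq> v" using that fs by (auto simp: fin_simple_graph_def)
    then have "u \<in> N v \<or> v \<in> N u"
      using total that by (auto simp: total_on_def N_def insert_commute)
    then show ?thesis using new[of u] new[of v] by (metis imageI)
  qed
  ultimately show ?thesis unfolding proper_coloring_def by blast
qed

lemma chromatic_number_le:
  "proper_coloring H k g \<Longrightarrow> chromatic_number H \<le> k"
  unfolding chromatic_number_def by (rule Least_le) blast

section \<open>Powers of graphs of bounded expansion\<close>

text \<open>Here the greedy choice is made: \<open>ex_small_fan\<close> serves every remaining set,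
  and the resulting bound involves only \<open>b\<close> and \<open>r\<close>, so it is uniform over
  the class.\<close>

lemma bounded_expansion_wreach:
  assumes fs: "\<And>G. G \<in> C \<Longrightarrow> fin_simple_graph G" and "bounded_expansion C"
  shows "\<exists>k. \<forall>G\<in>C. \<exists>f :: 'a \<Rightarrow> nat. \<forall>v\<in>verts G. card (wreach G f r v) \<le> k"
proof -
  obtain b where b: "\<And>G. G \<in> C \<Longrightarrow> minor_sparse (2 * r) b G"
    using bounded_expansion_minor_sparse[OF assms] by blast
  define k where "k = b * (1 + b * (2 * r)) * (2 * (4 * b + 1))"
  have "\<exists>f :: 'a \<Rightarrow> nat. \<forall>v\<in>verts G. card (wreach G f r v) \<le> (k * r + 1) ^ r" if G: "G \<in> C" for G
  proof -
    have fin: "finite (verts G)" using fs[OF G] by (simp add: fin_simple_graph_def)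
    have "\<exists>v\<in>S. \<forall>Q. fan G r v (S - {v}) Q \<longrightarrow> card Q \<le> k" if "S \<subseteq> verts G" "S \<noteq> {}" for S
      unfolding k_def using ex_small_fan[OF fs[OF G] b[OF G] that] .
    from elimination_ranking[of "verts G" "\<lambda>v S. \<forall>Q. fan G r v S Q \<longrightarrow> card Q \<le> k", OF fin this]
    obtain f :: "'a \<Rightarrow> nat" where "inj_on f (verts G)"
      and "\<And>v Q. v \<in> verts G \<Longrightarrow> fan G r v {u \<in> verts G. f u < f v} Q \<Longrightarrow> card Q \<le> k"
      by auto
    then show ?thesis
      using card_wreach_le[OF fin, of f r k r] by auto
  qed
  then show ?thesis by blast
qed

lemma wreach_meet:
  assumes "gdist G u v \<le> enat d"
  obtains z where "z \<in> wreach G f d u \<and> gdist G z v \<le> enat (d div 2) \<or>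
    z \<in> wreach G f d v \<and> gdist G z u \<le> enat (d div 2)"
proof -
  obtain p where p: "walk G u p v" "length p \<le> Suc d"
    using assms by (auto simp: gdist_le_iff)
  then have "set p \<noteq> {}" by (simp add: walk_def)
  then obtain z where z: "z \<in> set p" "\<And>x. x \<in> set p \<Longrightarrow> f z \<le> f x"
    by (metis (no_types, lifting) arg_min_if_finite List.finite_set leI)
  then obtain a c where ac: "p = a @ z # c" using split_list by metis
  have uz: "walk G u (a @ [z]) z" and zv: "walk G z (z # c) v"
    using p(1) ac walk_prefix walk_suffix by metis+
  have vz: "walk G v (rev (z # c)) z" and zu: "walk G z (rev (a @ [z])) u"
    using walk_rev[OF zv] walk_rev[OF uz] by auto
  have "z \<in> wreach G f d u"
    using uz p(2) z(2) unfolding wreach_def ac by (auto intro!: exI[of _ "a @ [z]"])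
  moreover have "z \<in> wreach G f d v"
    using vz p(2) z(2) unfolding wreach_def ac by (auto intro!: exI[of _ "rev (z # c)"])
  \<comment> \<open>The two parts of the walk have at most \<open>d\<close> steps in total, and
    \<open>z\<close> is counted in both lists.\<close>
  moreover have "length (z # c) \<le> Suc (d div 2) \<or> length (rev (a @ [z])) \<le> Suc (d div 2)"
    using p(2) ac by auto
  ultimately show thesis
    using that zv zu unfolding gdist_le_iff by blast
qed

lemma adj_graph_power:
  "adj (graph_power d G) u v \<longleftrightarrow>
     u \<in> verts G \<and> v \<in> verts G \<and> u \<noteq> v \<and> gdist G u v \<le> enat d"
  using gdist_le_commute by (auto simp: graph_power_def doubleton_eq_iff)

text \<open>Each edge \<open>uv\<close> is oriented so that the \<open>f\<close>-least vertex \<open>z\<close> of a short walk between its ends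
  is within \<open>d div 2\<close> of the head. For fixed \<open>z\<close> the possible heads form a clique of \<open>H\<close>.\<close>

lemma induced_power_min_degree:
  assumes fs: "fin_simple_graph G" and H: "induced_subgraph H (graph_power d G)"
    and wreach: "\<And>v. v \<in> verts G \<Longrightarrow> card (wreach G f d v) \<le> k"
    and W: "W \<subseteq> verts H" "W \<noteq> {}"
  shows "\<exists>v\<in>W. card {u \<in> W. adj H v u} \<le> 2 * (k * clique_number H)"
proof (rule ccontr)
  let ?D = "k * clique_number H"
  assume "\<not> ?thesis"
  then have large: "2 * ?D + 1 \<le> card {u \<in> W. adj H v u}" if "v \<in> W" for v
    using that by (auto simp: not_le)
  have HG: "verts H \<subseteq> verts G"
    using H by (simp add: induced_subgraph_def graph_power_def)
  have finG: "finite (verts G)" using fs by (simp add: fin_simple_graph_def)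
  have finH: "finite (verts H)" using HG finG by (rule finite_subset)
  have finW: "finite W" using W(1) finH by (rule finite_subset)
  have adj: "adj H u v \<longleftrightarrow> u \<noteq> v \<and> gdist G u v \<le> enat d" if "u \<in> verts H" "v \<in> verts H" for u v
    using H HG that adj_graph_power[of u v d G] by (auto simp: induced_subgraph_def)
  define near where "near z = {v \<in> W. gdist G z v \<le> enat (d div 2)}" for z
  have near: "card (near z) \<le> clique_number H" for z
  proof (rule card_clique_le_clique_number[OF finH])
    have "gdist G u v \<le> enat d" if "u \<in> near z" "v \<in> near z" for u v
    proof -
      have "gdist G u v \<le> enat (d div 2 + d div 2)"
        using that by (intro gdist_le_trans[of G u z] gdist_le_commute[of G z u]) (auto simp: near_def)
      also have "\<dots> \<le> enat d" by simp
      finally show ?thesis .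
    qed
    moreover have "near z \<subseteq> verts H" using W(1) by (auto simp: near_def)
    ultimately show "clique H (near z)"
      unfolding clique_def using adj by (meson subsetD)
  qed
  \<comment> \<open>This set may also contain vertices not adjacent to \<open>u\<close>; what
    matters is its size and that every edge inside \<open>W\<close> has one end in the
    \<open>out\<close> set of the other.\<close>
  define out where "out u = (\<Union>z\<in>wreach G f d u. near z)" for u
  have out: "card (out u) \<le> ?D" and fin_out: "finite (out u)" if "u \<in> W" for u
  proof -
    have u: "u \<in> verts G" using that W HG by blast
    have "wreach G f d u \<subseteq> verts G" by (auto simp: wreach_def walk_def)
    then have fin: "finite (wreach G f d u)" using finG by (rule finite_subset)
    have "card (out u) \<le> (\<Sum>z\<in>wreach G f d u. card (near z))"
      unfolding out_def by (rule card_UN_le[OF fin])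
    also have "\<dots> \<le> (\<Sum>z\<in>wreach G f d u. clique_number H)"
      by (intro sum_mono near)
    also have "\<dots> \<le> ?D" using wreach[OF u] by simp
    finally show "card (out u) \<le> ?D" .
    have "out u \<subseteq> W" by (auto simp: out_def near_def)
    then show "finite (out u)" using finW by (rule finite_subset)
  qed
  \<comment> \<open>Adjacent ordered pairs are covered by the arcs into \<open>out\<close> and their
    reversals, which is where the factor 2 arises.\<close>
  have "(\<Sum>v\<in>W. card {u \<in> W. adj H v u}) = card (SIGMA v:W. {u \<in> W. adj H v u})"
    using finW by simp
  also have "\<dots> \<le> card (Sigma W out \<union> prod.swap ` Sigma W out)"
  proof (rule card_mono)
    show "finite (Sigma W out \<union> prod.swap ` Sigma W out)"
      using finW fin_out by auto
    show "(SIGMA v:W. {u \<in> W. adj H v u}) \<subseteq> Sigma W out \<union> prod.swap ` Sigma W out"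
    proof clarify
      fix u v assume uv: "u \<in> W" "v \<in> W" "adj H u v" and "(u, v) \<notin> prod.swap ` Sigma W out"
      then have not_out: "u \<notin> out v" by force
      have "gdist G u v \<le> enat d" using adj[of u v] uv W by blast
      then obtain z where "z \<in> wreach G f d u \<and> gdist G z v \<le> enat (d div 2) \<or>
          z \<in> wreach G f d v \<and> gdist G z u \<le> enat (d div 2)"
        by (rule wreach_meet)
      then have "v \<in> out u"
        using not_out uv unfolding out_def near_def by blast
      then show "v \<in> out u" .
    qed
  qed
  also have "\<dots> \<le> card (Sigma W out) + card (prod.swap ` Sigma W out)"
    by (rule card_Un_le)
  also have "\<dots> \<le> 2 * card (Sigma W out)"
    using card_image_le[of "Sigma W out" prod.swap] finW fin_out by auto
  also have "card (Sigma W out) = (\<Sum>u\<in>W. card (out u))"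
    using finW fin_out by simp
  also have "\<dots> \<le> (\<Sum>u\<in>W. ?D)"
    by (intro sum_mono out)
  finally have "(\<Sum>v\<in>W. card {u \<in> W. adj H v u}) \<le> 2 * ?D * card W" by (simp add: ac_simps)
  moreover have "(\<Sum>v\<in>W. 2 * ?D + 1) \<le> (\<Sum>v\<in>W. card {u \<in> W. adj H v u})"
    by (intro sum_mono large)
  ultimately have "(2 * ?D + 1) * card W \<le> 2 * ?D * card W"
    by (simp add: mult.commute)
  then show False using finW W(2) by simp
qed

theorem theorem5p1:
  fixes C :: "'a graph set" and d :: nat
  assumes "\<And>G. G \<in> C \<Longrightarrow> fin_simple_graph G"
    and "bounded_expansion C"
  shows "\<exists>c::nat. c > 0 \<and>
    (\<forall>H \<in> hereditary_closure (graph_power d ` C).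
       1 / real c * real (col H) \<le> real (clique_number H) \<and>
       clique_number H \<le> chromatic_number H \<and>
       chromatic_number H \<le> col H)"
proof -
  obtain k where k: "\<And>G. G \<in> C \<Longrightarrow> \<exists>f :: 'a \<Rightarrow> nat. \<forall>v\<in>verts G. card (wreach G f d v) \<le> k"
    using bounded_expansion_wreach[OF assms, of d] by blast
  \<comment> \<open>The summand 1 of the degeneracy bound is absorbed by a clique number of at least
    1; it also keeps \<open>c\<close> positive for \<open>k = 0\<close>.\<close>
  define c where "c = 2 * k + 1"
  have "col H \<le> c * clique_number H \<and> clique_number H \<le> chromatic_number H \<and>
      chromatic_number H \<le> col H" if mem: "H \<in> hereditary_closure (graph_power d ` C)" for H
  proof -
    obtain G where G: "G \<in> C" and H: "induced_subgraph H (graph_power d G)"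
      using mem by (auto simp: hereditary_closure_def)
    have "verts H \<subseteq> verts G" using H by (simp add: induced_subgraph_def graph_power_def)
    then have fin: "finite (verts H)"
      using assms(1)[OF G] finite_subset by (auto simp: fin_simple_graph_def)
    have fsH: "fin_simple_graph H"
      using H fin by (auto simp: fin_simple_graph_def induced_subgraph_def graph_power_def)
    have "col H \<le> c * clique_number H"
    proof (cases "verts H = {}")
      \<comment> \<open>Without vertices there is no clique of size 1 to absorb the summand, but the
        coloring number is 0 by convention.\<close>
      case True
      then have "linear_order_on (verts H) {}" by simp
      then have "col H \<le> col_ord H {}"
        unfolding col_def by (intro Min_le finite_col_ords fin) blast
      then show ?thesis using True by (simp add: col_ord_def)
    next
      case False
      then obtain v where "v \<in> verts H" by blast
      then have "clique H {v}" by (simp add: clique_def)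
      then have pos: "1 \<le> clique_number H"
        using card_clique_le_clique_number[OF fin] by fastforce
      obtain f :: "'a \<Rightarrow> nat" where f: "\<And>v. v \<in> verts G \<Longrightarrow> card (wreach G f d v) \<le> k"
        using k[OF G] by blast
      have "col H \<le> 2 * (k * clique_number H) + 1"
        by (rule col_le[OF fsH induced_power_min_degree[OF assms(1)[OF G] H f]])
      then show ?thesis using pos by (simp add: c_def algebra_simps)
    qed
    moreover obtain g where g: "proper_coloring H (col H) g"
      using proper_coloring_col[OF fsH] by blast
    ultimately show ?thesis
      using clique_number_le_chromatic_number[OF g] chromatic_number_le[OF g] by blast
  qed
  moreover have "1 / real c * real m \<le> real n" if "m \<le> c * n" for m n
  proof -
    have "real m \<le> real c * real n" using that by (metis of_nat_le_iff of_nat_mult)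
    then show ?thesis by (simp add: c_def divide_le_eq mult.commute)
  qed
  moreover have "c > 0" by (simp add: c_def)
  ultimately show ?thesis by blast
qed

end
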